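(* Let $v$ be a self-similar weak solution of $u_t+f(u)_x=0$ and let $\xi_\star\in\mathbb R$ be an ess-im discontinuity point for $v$. For any $u^-\in\mathcal A^-(v;\xi_\star)$ and any $u^+\in\mathcal A^+(v;\xi_\star)$, the Rankine--Hugoniot condition $$-\xi_\star\,(u^+-u^-)+f(u^+)-f(u^-)=0$$ is satisfied.
   Context: Let $n\ge 1$, let $\mathbb U\subseteq\mathbb R^n$ be open, let $f:\mathbb U\to\mathbb R^n$ be $C^2$, and $A:=Df$. $\mathbb U_{SH}\subseteq\mathbb U$ is the set of states $u$ at which $A(u)$ has $n$ real, distinct eigenvalues. It is assumed that the convex hull of $\mathbb U_{SH}$ is contained in $\mathbb U$. For $v\in L^\infty(\mathbb R;\mathbb R^n)$ and measurable $J\subseteq\mathbb R$, $\operatorname{ess\,im} v|_J$ is the set of $u\in\mathbb R^n$ such that $v^{-1}[U]\cap J$ has positive Lebesgue measure for every neighborhood $U$ of $u$; $\operatorname{ess\,im}v:=\operatorname{ess\,im}v|_{\mathbb R}$. The left and right ess-im accumulation sets are $\mathcal A^-(v;\xi):=\bigcap_{r>0}\operatorname{ess\,im}v|_{(\xi-r,\xi)}$ and $\mathcal A^+(v;\xi):=\bigcap_{r>0}\operatorname{ess\,im}v|_{(\xi,\xi+r)}$. The point $\xi$ is an ess-im continuity point for $v$ if $\mathcal A^-(v;\xi)$ and $\mathcal A^+(v;\xi)$ are the same singleton; otherwise it is an ess-im discontinuity point. A self-similar weak solution is a function $v\in L^\infty(\mathbb R;\mathbb R^n)$ with $\operatorname{ess\,im}v\subseteq\mathbb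 U_{SH}$ such that $\int_{-\infty}^\infty\{\frac{d\psi}{d\xi}\cdot[-\xi v+f(v)]-\psi\cdot v\}\,d\xi=0$ for all $\psi\in C^1_c(\mathbb R;\mathbb R^n)$. *)

theory Defs
  imports "HOL-Analysis.Analysis"
begin

definition C2_on :: "('a::euclidean_space \<Rightarrow> 'b::euclidean_space) \<Rightarrow> 'a set \<Rightarrow> bool" where
  "C2_on f U \<longleftrightarrow>
    (\<exists>(f1 :: 'a \<Rightarrow> 'a \<Rightarrow>\<^sub>L 'b) (f2 :: 'a \<Rightarrow> 'a \<Rightarrow>\<^sub>L 'a \<Rightarrow>\<^sub>L 'b).
      (\<forall>x\<in>U. (f has_derivative blinfun_apply (f1 x)) (at x)) \<and>
      (\<forall>x\<in>U. (f1 has_derivative blinfun_apply (f2 x)) (at x)) \<and>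
      continuous_on U f2)"

definition real_eigenvalues :: "real^'n^'n \<Rightarrow> real set" where
  "real_eigenvalues M = {c. \<exists>x. x \<noteq> 0 \<and> M *v x = c *\<^sub>R x}"

text \<open>The strictly hyperbolic states: \<^term>\<open>jacobian f (at u)\<close> is the matrix \<open>A(u) = Df(u)\<close>.\<close>

definition strictly_hyperbolic :: "(real^'n) set \<Rightarrow> (real^'n \<Rightarrow> real^'n) \<Rightarrow> (real^'n) set" where
  "strictly_hyperbolic U f =
    {u\<in>U. card (real_eigenvalues (jacobian f (at u))) = CARD('n)}"

definition L_infinity :: "(real \<Rightarrow> real^'n) \<Rightarrow> bool" where
  "L_infinity v \<longleftrightarrow>
    v \<in> borel_measurable lebesgue \<and> (\<exists>B. AE \<xi> in lebesgue. norm (v \<xi>) \<le> B)"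

text \<open>Meaningful for Lebesgue measurable \<open>v\<close> and \<open>J\<close> only, since \<^const>\<open>emeasure\<close> vanishes on
  nonmeasurable sets.\<close>

definition ess_im_on :: "(real \<Rightarrow> real^'n) \<Rightarrow> real set \<Rightarrow> (real^'n) set" where
  "ess_im_on v J =
    {u. \<forall>W. open W \<and> u \<in> W \<longrightarrow> emeasure lebesgue (v -` W \<inter> J) > 0}"

abbreviation ess_im :: "(real \<Rightarrow> real^'n) \<Rightarrow> (real^'n) set" where
  "ess_im v \<equiv> ess_im_on v UNIV"

definition ess_acc_left :: "(real \<Rightarrow> real^'n) \<Rightarrow> real \<Rightarrow> (real^'n) set" where
  "ess_acc_left v \<xi> = (\<Inter>r\<in>{0<..}. ess_im_on v {\<xi> - r<..<\<xi>})"

definition ess_acc_right :: "(real \<Rightarrow> real^'n) \<Rightarrow> real \<Rightarrow> (real^'n) set" where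
  "ess_acc_right v \<xi> = (\<Inter>r\<in>{0<..}. ess_im_on v {\<xi><..<\<xi> + r})"

definition ess_continuity_point :: "(real \<Rightarrow> real^'n) \<Rightarrow> real \<Rightarrow> bool" where
  "ess_continuity_point v \<xi> \<longleftrightarrow> (\<exists>u. ess_acc_left v \<xi> = {u} \<and> ess_acc_right v \<xi> = {u})"

abbreviation ess_discontinuity_point :: "(real \<Rightarrow> real^'n) \<Rightarrow> real \<Rightarrow> bool" where
  "ess_discontinuity_point v \<xi> \<equiv> \<not> ess_continuity_point v \<xi>"

definition C1_compact_support :: "(real \<Rightarrow> real^'n) \<Rightarrow> bool" where
  "C1_compact_support \<psi> \<longleftrightarrow> \<psi> C1_differentiable_on UNIV \<and> compact (closure {\<xi>. \<psi> \<xi> \<noteq> 0})"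

text \<open>The flux \<open>f\<close> is a total function, but only its values on \<open>U\<close> matter: \<open>v \<xi> \<in> ess_im v \<subseteq> U\<close>
  for almost every \<open>\<xi>\<close>. As \<open>ess_im v\<close> is compact and \<open>f\<close> continuous on \<open>U\<close>, the integrand below is
  integrable, so the integral never takes the default value \<open>0\<close> of a non-integrable function.\<close>

definition self_similar_weak_solution ::
    "(real^'n) set \<Rightarrow> (real^'n \<Rightarrow> real^'n) \<Rightarrow> (real \<Rightarrow> real^'n) \<Rightarrow> bool" where
  "self_similar_weak_solution U f v \<longleftrightarrow>
    L_infinity v \<and> ess_im v \<subseteq> strictly_hyperbolic U f \<and>
    (\<forall>\<psi>. C1_compact_support \<psi> \<longrightarrow>
      (LINT \<xi>|lebesgue. vector_derivative \<psi> (at \<xi>) \<bullet> (- \<xi> *\<^sub>R v \<xi> + f (v \<xi>)) - \<psi> \<xi> \<bullet> v \<xi>) = 0)"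

end

theory Submission
  imports Defs
begin

text \<open>The weak equation says that the flux \<open>F \<xi> = - \<xi> v \<xi> + f (v \<xi>)\<close> has the bounded weak derivative
  \<open>- v\<close>, so \<open>F\<close> agrees almost everywhere with a Lipschitz function. Test functions rising from \<open>0\<close> to
  a constant on \<open>(a, a + h)\<close> and falling back to \<open>0\<close> on \<open>(b, b + h)\<close> compare the averages of \<open>F\<close> on
  these two intervals, and letting \<open>h\<close> tend to \<open>0\<close> at Lebesgue points gives
  \<open>\<bar>F b - F a\<bar> \<le> B (b - a)\<close> off a null set. States in the two accumulation sets are limits of
  values of \<open>v\<close> at such points \<open>a\<close>, \<open>b\<close> tending to \<open>\<xi>s\<close> from the left and from the right, so
  the flux has the same limit along both.\<close>

section \<open>Continuously differentiable ramps\<close>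

text \<open>For negative \<open>x\<close> the interval \<open>{0..x}\<close> is empty and the
  integral is 0; since \<open>\<phi>\<close> vanishes there, this is still a genuine
  antiderivative.\<close>

lemma integral_from_zero_has_real_derivative:
  fixes \<phi> :: "real \<Rightarrow> real"
  assumes cont: "continuous_on UNIV \<phi>" and zero: "\<And>x. x \<le> 0 \<Longrightarrow> \<phi> x = 0"
  shows "((\<lambda>x. integral {0..x} \<phi>) has_real_derivative \<phi> x) (at x)"
proof -
  \<comment> \<open>A base point left of both 0 and \<open>x\<close> makes \<open>x\<close> interior
    to \<open>{L..x+1}\<close>, so the one-sided derivative becomes two-sided.\<close>
  define L where "L = min x 0 - 1"
  have L: "L < x" "L < 0"
    by (auto simp: L_def)
  have int: "\<phi> integrable_on {c..d}" for c d
    using continuous_on_subset[OF cont] by (intro integrable_continuous_real) auto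
  have null: "integral {L..y} \<phi> = 0" if "y \<le> 0" for y
    using integral_cong[of "{L..y}" \<phi> "\<lambda>_. 0"] zero that by auto
  have eq: "integral {L..y} \<phi> = integral {0..y} \<phi>" for y
  proof (cases "0 \<le> y")
    case True
    then show ?thesis
      using Henstock_Kurzweil_Integration.integral_combine[of L 0 y \<phi>] int null[of 0] L by auto
  next
    case False
    then show ?thesis
      using null[of y] by auto
  qed
  have "((\<lambda>u. integral {L..u} \<phi>) has_vector_derivative \<phi> x) (at x within {L..x+1})"
    using L continuous_on_subset[OF cont] by (intro integral_has_vector_derivative) auto
  then show ?thesis
    using L by (simp add: eq at_within_Icc_at has_real_derivative_iff_has_vector_derivative)
qed

text \<open>\<open>\<phi>\<close> is a trapezoid with flanks of slope 1/\<open>\<epsilon>\<close>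
  and \<open>T\<close> its antiderivative, a smoothed ramp. For \<open>\<epsilon>\<close> >
  \<open>h\<close>/2 the plateau clause is vacuous.\<close>

lemma C1_step_exists:
  fixes h \<epsilon> :: real
  assumes "0 < h" "0 < \<epsilon>"
  shows "\<exists>T \<phi>. (\<forall>x. (T has_real_derivative \<phi> x) (at x)) \<and> continuous_on UNIV \<phi> \<and>
    (\<forall>x. 0 \<le> \<phi> x \<and> \<phi> x \<le> 1) \<and> (\<forall>x. x \<notin> {0<..<h} \<longrightarrow> \<phi> x = 0) \<and>
    (\<forall>x. \<epsilon> \<le> x \<and> x \<le> h - \<epsilon> \<longrightarrow> \<phi> x = 1) \<and>
    (\<forall>x. 0 \<le> T x \<and> T x \<le> h) \<and> (\<forall>x\<le>0. T x = 0) \<and> (\<forall>x\<ge>h. T x = T h)"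
proof -
  define \<phi> where "\<phi> = (\<lambda>x. max 0 (min 1 (min x (h - x) / \<epsilon>)))"
  define T where "T = (\<lambda>x. integral {0..x} \<phi>)"
  have cont: "continuous_on S \<phi>" for S
    unfolding \<phi>_def using assms by (intro continuous_intros) auto
  then have int: "\<phi> integrable_on {c..d}" for c d
    by (intro integrable_continuous_real)
  have bound: "0 \<le> \<phi> x" "\<phi> x \<le> 1" for x
    by (auto simp: \<phi>_def)
  have zero: "\<phi> x = 0" if "x \<notin> {0<..<h}" for x
  proof -
    have "min x (h - x) / \<epsilon> \<le> 0"
      using that assms by (auto simp: divide_le_0_iff min_def)
    then show ?thesis
      by (simp add: \<phi>_def)
  qed
  have one: "\<phi> x = 1" if "\<epsilon> \<le> x" "x \<le> h - \<epsilon>" for x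
  proof -
    have "1 \<le> min x (h - x) / \<epsilon>"
      using that assms by (auto simp: le_divide_eq)
    then show ?thesis
      by (simp add: \<phi>_def)
  qed
  have deriv: "(T has_real_derivative \<phi> x) (at x)" for x
    unfolding T_def using cont zero by (intro integral_from_zero_has_real_derivative) auto
  have T0: "T x = 0" if "x \<le> 0" for x
    using that by (cases "x = 0") (auto simp: T_def)
  have Th: "T x = T h" if "h \<le> x" for x
    using Henstock_Kurzweil_Integration.integral_combine[of 0 h x \<phi>] int that assms zero
      integral_cong[of "{h..x}" \<phi> "\<lambda>_. 0"]
    by (auto simp: T_def)
  have "T x \<le> h" if "x \<le> h" for x
  proof (cases "0 \<le> x")
    case True
    have "T x \<le> integral {0..x} (\<lambda>_. 1)"
      unfolding T_def using int bound by (intro integral_le) auto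
    then show ?thesis
      using True that by simp
  qed (use T0 assms in auto)
  then have Tle: "T x \<le> h" for x
    using Th[of x] by (cases "x \<le> h") fastforce+
  have "0 \<le> T x" for x
    unfolding T_def using int bound by (intro integral_nonneg) auto
  then show ?thesis
    using cont bound zero one deriv T0 Th Tle by (intro exI[of _ T] exI[of _ \<phi>]) blast
qed

section \<open>Bounded weak derivatives and Lipschitz estimates\<close>

text \<open>The distributional equation F' = w. The derivative and a bound for the support of
  \<open>\<psi>\<close> are quantified explicitly, so that test functions can be supplied without
  computing \<open>vector_derivative\<close> or a closure.\<close>

definition has_weak_derivative :: "(real \<Rightarrow> 'a::euclidean_space) \<Rightarrow> (real \<Rightarrow> 'a) \<Rightarrow> bool" where
  "has_weak_derivative F w \<longleftrightarrow>
    (\<forall>\<psi> \<psi>' R. (\<forall>x. (\<psi> has_vector_derivative \<psi>' x) (at x)) \<and> continuous_on UNIV \<psi>' \<and>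
      (\<forall>x. R < \<bar>x\<bar> \<longrightarrow> \<psi> x = 0) \<longrightarrow>
      (LINT x|lebesgue. \<psi>' x \<bullet> F x + \<psi> x \<bullet> w x) = 0)"

text \<open>The test function has height at most \<open>h\<close> and support in an interval of
  length \<open>b + h - a\<close>, which gives the right-hand side. The two intervals may
  overlap.\<close>

lemma weak_derivative_interval_bound:
  fixes F w :: "real \<Rightarrow> 'a::euclidean_space"
  assumes F: "\<And>a b. set_integrable lebesgue {a..b} F"
    and w: "w \<in> borel_measurable lebesgue" "AE x in lebesgue. norm (w x) \<le> B"
    and weak: "has_weak_derivative F w"
    and ab: "a \<le> b" and h: "0 < h"
  shows "norm (integral {b..b+h} F - integral {a..a+h} F) \<le> h * B * (b + h - a)"
proof -
  define D where "D = integral {b..b+h} F - integral {a..a+h} F"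
  \<comment> \<open>The unit vector along \<open>D\<close> turns the vector estimate into a scalar
    one, as \<open>D \<bullet> e = norm D\<close>; for \<open>D = 0\<close> it is 0.\<close>
  define e where "e = sgn D"
  have e: "norm e \<le> 1"
    by (simp add: e_def norm_sgn)
  \<comment> \<open>The exact piecewise linear ramp is not C1, so it is approximated with
    \<open>\<epsilon>\<close> = 1/(n+1).\<close>
  have "\<forall>n::nat. \<exists>T \<phi>. (\<forall>x. (T has_real_derivative \<phi> x) (at x)) \<and> continuous_on UNIV \<phi> \<and>
    (\<forall>x. 0 \<le> \<phi> x \<and> \<phi> x \<le> 1) \<and> (\<forall>x. x \<notin> {0<..<h} \<longrightarrow> \<phi> x = 0) \<and>
    (\<forall>x. inverse (real (Suc n)) \<le> x \<and> x \<le> h - inverse (real (Suc n)) \<longrightarrow> \<phi> x = 1) \<and>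
    (\<forall>x. 0 \<le> T x \<and> T x \<le> h) \<and> (\<forall>x\<le>0. T x = 0) \<and> (\<forall>x\<ge>h. T x = T h)"
    using h by (intro allI C1_step_exists) auto
  then obtain T \<phi> where T\<phi>: "\<forall>n::nat. (\<forall>x. (T n has_real_derivative \<phi> n x) (at x)) \<and>
    continuous_on UNIV (\<phi> n) \<and>
    (\<forall>x. 0 \<le> \<phi> n x \<and> \<phi> n x \<le> 1) \<and> (\<forall>x. x \<notin> {0<..<h} \<longrightarrow> \<phi> n x = 0) \<and>
    (\<forall>x. inverse (real (Suc n)) \<le> x \<and> x \<le> h - inverse (real (Suc n)) \<longrightarrow> \<phi> n x = 1) \<and>
    (\<forall>x. 0 \<le> T n x \<and> T n x \<le> h) \<and> (\<forall>x\<le>0. T n x = 0) \<and> (\<forall>x\<ge>h. T n x = T n h)"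
    unfolding choice_iff by blast
  have deriv: "(T n has_real_derivative \<phi> n x) (at x)"
    and cont: "continuous_on UNIV (\<phi> n)" and bound: "0 \<le> \<phi> n x" "\<phi> n x \<le> 1"
    and zero: "x \<notin> {0<..<h} \<Longrightarrow> \<phi> n x = 0"
    and one: "inverse (real (Suc n)) \<le> x \<Longrightarrow> x \<le> h - inverse (real (Suc n)) \<Longrightarrow> \<phi> n x = 1"
    and T: "0 \<le> T n x" "T n x \<le> h" "x \<le> 0 \<Longrightarrow> T n x = 0" "h \<le> x \<Longrightarrow> T n x = T n h" for n x
    using T\<phi> by blast+
  \<comment> \<open>As \<open>n\<close> grows, \<open>\<phi> n\<close> tends to the indicator of \<open>(0, h)\<close> and \<open>\<psi> n\<close> to the trapezoid.\<close>
  define \<psi> where "\<psi> = (\<lambda>n x. T n (x - a) - T n (x - b))"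
  define \<psi>' where "\<psi>' = (\<lambda>n x. \<phi> n (x - a) - \<phi> n (x - b))"
  let ?I = "{a..b+h}"
  have deriv\<psi>: "(\<psi> n has_real_derivative \<psi>' n x) (at x)" for n x
    unfolding \<psi>_def \<psi>'_def
    by (auto intro!: derivative_eq_intros deriv[THEN DERIV_chain2])
  have cont\<psi>': "continuous_on UNIV (\<psi>' n)" for n
    unfolding \<psi>'_def by (intro continuous_intros continuous_on_compose2[OF cont]) auto
  have cont\<psi>: "continuous_on UNIV (\<psi> n)" for n
    using deriv\<psi> DERIV_isCont continuous_at_imp_continuous_on by blast
  have meas[measurable]: "\<psi> n \<in> borel_measurable lebesgue" "\<psi>' n \<in> borel_measurable lebesgue" for n
    using cont\<psi>[of n] cont\<psi>'[of n] by (auto intro!: measurable_completion borel_measurable_continuous_onI)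
  have supp: "\<psi> n x = 0" "\<psi>' n x = 0" if "x \<notin> ?I" for n x
  proof -
    consider "x < a" | "b + h < x"
      using \<open>x \<notin> ?I\<close> by force
    then show "\<psi> n x = 0"
      using T(3)[of "x - a" n] T(3)[of "x - b" n] T(4)[of "x - a" n] T(4)[of "x - b" n] ab
      by cases (auto simp: \<psi>_def)
    show "\<psi>' n x = 0"
      using that zero[of "x - a" n] zero[of "x - b" n] ab h by (auto simp: \<psi>'_def)
  qed
  have abs\<psi>: "\<bar>\<psi> n x\<bar> \<le> h" for n x
    using T(1,2)[of n "x - a"] T(1,2)[of n "x - b"] by (auto simp: \<psi>_def)
  have abs\<psi>': "\<bar>\<psi>' n x\<bar> \<le> 1" for n x
    using bound[of n "x - a"] bound[of n "x - b"] by (auto simp: \<psi>'_def)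
  have FI: "integrable lebesgue (\<lambda>x. indicat_real ?I x *\<^sub>R F x)"
    using F[of a "b + h"] by (simp add: set_integrable_def)
  \<comment> \<open>\<open>F\<close> is only locally integrable; cutting it off to the support of
    \<open>\<psi>' n\<close> provides an integrable dominating function independent of
    \<open>n\<close>.\<close>
  have eq\<psi>': "\<psi>' n x * (F x \<bullet> e) = \<psi>' n x * ((indicat_real ?I x *\<^sub>R F x) \<bullet> e)" for n x
    using supp[of x n] by (auto simp: indicator_def)
  have [measurable]: "(\<lambda>x. indicat_real ?I x *\<^sub>R F x) \<in> borel_measurable lebesgue"
    using FI by auto
  have dom: "norm (\<psi>' n x * (F x \<bullet> e)) \<le> norm (indicat_real ?I x *\<^sub>R F x)" for n x
  proof -
    have "\<bar>(indicat_real ?I x *\<^sub>R F x) \<bullet> e\<bar> \<le> norm (indicat_real ?I x *\<^sub>R F x) * 1"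
      by (rule order_trans[OF Cauchy_Schwarz_ineq2]) (intro mult_left_mono e, simp)
    then have "\<bar>\<psi>' n x\<bar> * \<bar>(indicat_real ?I x *\<^sub>R F x) \<bullet> e\<bar> \<le> 1 * (norm (indicat_real ?I x *\<^sub>R F x) * 1)"
      by (intro mult_mono abs\<psi>') auto
    then show ?thesis
      unfolding eq\<psi>' by (simp add: abs_mult)
  qed
  have domw: "AE x in lebesgue. norm (\<psi> n x * (w x \<bullet> e)) \<le> indicat_real ?I x * (h * B)" for n
    using w(2)
  proof eventually_elim
    case (elim x)
    have "\<bar>w x \<bullet> e\<bar> \<le> norm (w x) * norm e"
      by (rule Cauchy_Schwarz_ineq2)
    \<comment> \<open>The nonnegativity of \<open>B\<close> comes from 0 \<le>
      \<open>norm (w x)\<close> \<le> \<open>B\<close> at this point.\<close>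
    also have "\<dots> \<le> B * 1"
      using elim e by (intro mult_mono) (auto intro: order_trans[OF norm_ge_zero])
    finally have "\<bar>\<psi> n x\<bar> * \<bar>w x \<bullet> e\<bar> \<le> h * B"
      using abs\<psi>[of n x] h by (intro mult_mono) auto
    then show ?case
      using supp[of x n] by (auto simp: abs_mult indicator_def)
  qed
  have meas\<psi>'F[measurable]: "(\<lambda>x. \<psi>' n x * (F x \<bullet> e)) \<in> borel_measurable lebesgue" for n
    unfolding eq\<psi>' by measurable
  have int\<psi>': "integrable lebesgue (\<lambda>x. \<psi>' n x * (F x \<bullet> e))" for n
    using dom by (intro Bochner_Integration.integrable_bound[OF integrable_norm[OF FI]]) auto
  have intB: "integrable lebesgue (\<lambda>x. indicat_real ?I x * (h * B))"
    by (intro integrable_mult_left integrable_real_indicator) (auto simp: emeasure_lborel_Icc_eq)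
  have [measurable]: "w \<in> borel_measurable lebesgue" by fact
  have int\<psi>: "integrable lebesgue (\<lambda>x. \<psi> n x * (w x \<bullet> e))" for n
  proof (rule Bochner_Integration.integrable_bound[OF intB])
    show "AE x in lebesgue. norm (\<psi> n x * (w x \<bullet> e)) \<le> norm (indicat_real ?I x * (h * B))"
      using domw[of n] by eventually_elim auto
  qed measurable
  have eq: "(LINT x|lebesgue. \<psi>' n x * (F x \<bullet> e)) = - (LINT x|lebesgue. \<psi> n x * (w x \<bullet> e))" for n
  proof -
    have "(LINT x|lebesgue. (\<psi>' n x *\<^sub>R e) \<bullet> F x + (\<psi> n x *\<^sub>R e) \<bullet> w x) = 0"
    proof (intro weak[unfolded has_weak_derivative_def, rule_format,
          of "\<lambda>x. \<psi> n x *\<^sub>R e" "\<lambda>x. \<psi>' n x *\<^sub>R e" "\<bar>a\<bar> + \<bar>b\<bar> + h"] conjI allI impI)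
      show "((\<lambda>x. \<psi> n x *\<^sub>R e) has_vector_derivative \<psi>' n x *\<^sub>R e) (at x)" for x
        using has_vector_derivative_scaleR[OF deriv\<psi> has_vector_derivative_const] by simp
      show "continuous_on UNIV (\<lambda>x. \<psi>' n x *\<^sub>R e)"
        by (intro continuous_intros cont\<psi>')
      show "\<psi> n x *\<^sub>R e = 0" if "\<bar>a\<bar> + \<bar>b\<bar> + h < \<bar>x\<bar>" for x
      proof -
        have "x \<notin> ?I"
          using that h ab by auto
        then show ?thesis
          by (simp add: supp)
      qed
    qed
    then show ?thesis
      using int\<psi>[of n] int\<psi>'[of n] by (simp add: inner_commute)
  qed
  have le: "\<bar>LINT x|lebesgue. \<psi>' n x * (F x \<bullet> e)\<bar> \<le> h * B * (b + h - a)" for n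
  proof -
    have "norm (LINT x|lebesgue. \<psi> n x * (w x \<bullet> e)) \<le> (LINT x|lebesgue. norm (\<psi> n x * (w x \<bullet> e)))"
      by (rule Bochner_Integration.integral_norm_bound)
    also have "\<dots> \<le> (LINT x|lebesgue. indicat_real ?I x * (h * B))"
      by (rule integral_mono_AE[OF integrable_norm[OF int\<psi>] intB domw])
    also have "\<dots> = h * B * (b + h - a)"
      using ab h by simp
    finally show ?thesis
      by (simp add: eq)
  qed
  \<comment> \<open>The sign follows \<open>D\<close>, which subtracts the integral near
    \<open>a\<close> from the one near \<open>b\<close>; the limit of \<open>\<psi>' n\<close> is
    therefore \<open>- g\<close>.\<close>
  define g where "g = (\<lambda>x. (indicat_real {b<..<b+h} x - indicat_real {a<..<a+h} x))"
  have lim: "(\<lambda>n. \<psi>' n x) \<longlonglongrightarrow> - g x" for x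
  proof -
    have *: "(\<lambda>n. \<phi> n (x - c)) \<longlonglongrightarrow> indicat_real {c<..<c+h} x" for c
    proof (cases "x \<in> {c<..<c+h}")
      case True
      \<comment> \<open>Once 1/(n+1) is below the distance of \<open>x\<close> to both endpoints,
        \<open>x\<close> lies on the plateau.\<close>
      have "(\<lambda>n. inverse (real (Suc n))) \<longlonglongrightarrow> 0"
        by (rule LIMSEQ_inverse_real_of_nat)
      then have "eventually (\<lambda>n. inverse (real (Suc n)) < min (x - c) (h - (x - c))) sequentially"
        using True by (intro order_tendstoD) auto
      then have "eventually (\<lambda>n. \<phi> n (x - c) = 1) sequentially"
        by eventually_elim (rule one, auto)
      then show ?thesis
        using True by (simp add: tendsto_eventually)
    next
      case False
      then have "x - c \<notin> {0<..<h}"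
        by auto
      with False show ?thesis
        by (simp add: zero)
    qed
    show ?thesis
      unfolding g_def \<psi>'_def using tendsto_diff[OF *[of a] *[of b]] by simp
  qed
  have "(\<lambda>n. LINT x|lebesgue. \<psi>' n x * (F x \<bullet> e)) \<longlonglongrightarrow> (LINT x|lebesgue. - g x * (F x \<bullet> e))"
  proof (rule integral_dominated_convergence[OF _ _ integrable_norm[OF FI]])
    show "AE x in lebesgue. (\<lambda>n. \<psi>' n x * (F x \<bullet> e)) \<longlonglongrightarrow> - g x * (F x \<bullet> e)"
      by (intro AE_I2 tendsto_mult lim tendsto_const)
    show "(\<lambda>x. - g x * (F x \<bullet> e)) \<in> borel_measurable lebesgue"
      by (rule borel_measurable_LIMSEQ_real[OF tendsto_mult[OF lim tendsto_const] meas\<psi>'F])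
    show "AE x in lebesgue. norm (\<psi>' n x * (F x \<bullet> e)) \<le> norm (indicat_real ?I x *\<^sub>R F x)" for n
      using dom by auto
  qed auto
  then have "(\<lambda>n. \<bar>LINT x|lebesgue. \<psi>' n x * (F x \<bullet> e)\<bar>) \<longlonglongrightarrow> \<bar>LINT x|lebesgue. - g x * (F x \<bullet> e)\<bar>"
    by (rule tendsto_rabs)
  then have lim_le: "\<bar>LINT x|lebesgue. - g x * (F x \<bullet> e)\<bar> \<le> h * B * (b + h - a)"
    using le by (intro LIMSEQ_le_const2) auto
  \<comment> \<open>Passes from Bochner integrals over open intervals to the Henstock-Kurzweil
    integrals over closed ones in \<open>D\<close>.\<close>
  have part: "integrable lebesgue (\<lambda>x. indicat_real {c<..<c+h} x *\<^sub>R F x)"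
    "(LINT x|lebesgue. indicat_real {c<..<c+h} x *\<^sub>R F x) = integral {c..c+h} F" for c
  proof -
    have s: "set_integrable lebesgue {c<..<c+h} F"
      by (rule set_integrable_subset[OF F[of c "c + h"]]) auto
    then show "integrable lebesgue (\<lambda>x. indicat_real {c<..<c+h} x *\<^sub>R F x)"
      by (simp add: set_integrable_def)
    show "(LINT x|lebesgue. indicat_real {c<..<c+h} x *\<^sub>R F x) = integral {c..c+h} F"
      using set_lebesgue_integral_eq_integral(2)[OF s] integral_open_interval_real[of c "c + h" F]
      by (simp add: set_lebesgue_integral_def)
  qed
  have "(LINT x|lebesgue. - g x * (F x \<bullet> e)) = (LINT x|lebesgue.
      (indicat_real {a<..<a+h} x *\<^sub>R F x) \<bullet> e - (indicat_real {b<..<b+h} x *\<^sub>R F x) \<bullet> e)"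
    by (simp add: g_def algebra_simps)
  also have "\<dots> = (integral {a..a+h} F - integral {b..b+h} F) \<bullet> e"
    using part by (simp add: Bochner_Integration.integral_diff inner_diff_left del: inner_scaleR_left)
  also have "\<dots> = - (D \<bullet> e)"
    by (simp add: D_def inner_diff_left)
  also have "D \<bullet> e = norm D"
    by (cases "D = 0") (simp_all add: e_def sgn_div_norm power2_norm_eq_inner[symmetric] power2_eq_square)
  finally show ?thesis
    using lim_le by (simp add: D_def)
qed

text \<open>Divide the interval bound by \<open>h\<close> and let \<open>h\<close> tend to 0 from
  the right; \<open>N\<close> collects the points where the right averages of \<open>F\<close> need
  not converge to its value.\<close>

lemma weak_derivative_lipschitz_off_negligible:
  fixes F w :: "real \<Rightarrow> 'a::euclidean_space"
  assumes F: "\<And>a b. set_integrable lebesgue {a..b} F"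
    and w: "w \<in> borel_measurable lebesgue" "AE x in lebesgue. norm (w x) \<le> B"
    and weak: "has_weak_derivative F w"
  obtains N where "negligible N"
    "\<And>a b. a \<notin> N \<Longrightarrow> b \<notin> N \<Longrightarrow> a \<le> b \<Longrightarrow> norm (F b - F a) \<le> B * (b - a)"
proof -
  have "F integrable_on cbox a b" for a b
    using set_lebesgue_integral_eq_integral(1)[OF F] by simp
  then obtain N where N: "negligible N"
    "\<And>x e. x \<notin> N \<Longrightarrow> 0 < e \<Longrightarrow> \<exists>d>0. \<forall>h. 0 < h \<and> h < d \<longrightarrow>
       norm (integral (cbox x (x + h *\<^sub>R One)) F /\<^sub>R h ^ DIM(real) - F x) < e"
    using integrable_ccontinuous_explicit by metis
  have lim: "((\<lambda>h. integral {x..x+h} F /\<^sub>R h) \<longlongrightarrow> F x) (at_right 0)" if "x \<notin> N" for x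
    unfolding tendsto_iff
  proof (intro allI impI)
    fix e :: real assume "0 < e"
    with N(2)[OF that, of e] show "\<forall>\<^sub>F h in at_right 0. dist (integral {x..x+h} F /\<^sub>R h) (F x) < e"
      unfolding eventually_at_right_field by (simp add: dist_norm) blast
  qed
  show thesis
  proof
    fix a b assume a: "a \<notin> N" and b: "b \<notin> N" and ab: "a \<le> b"
    have l: "((\<lambda>h. norm (integral {b..b+h} F /\<^sub>R h - integral {a..a+h} F /\<^sub>R h)) \<longlongrightarrow> norm (F b - F a)) (at_right 0)"
      by (intro tendsto_intros lim a b)
    have r: "((\<lambda>h. B * (b + h - a)) \<longlongrightarrow> B * (b + 0 - a)) (at_right 0)"
      by (intro tendsto_intros)
    have "\<forall>\<^sub>F h in at_right 0. norm (integral {b..b+h} F /\<^sub>R h - integral {a..a+h} F /\<^sub>R h) \<le> B * (b + h - a)"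
      using eventually_at_right_less[of 0]
    proof eventually_elim
      case (elim h)
      have "norm (integral {b..b+h} F - integral {a..a+h} F) \<le> h * B * (b + h - a)"
        by (rule weak_derivative_interval_bound[OF F w weak ab elim])
      then have "norm (integral {b..b+h} F - integral {a..a+h} F) / h \<le> B * (b + h - a)"
        using elim by (simp add: divide_le_eq mult_ac)
      then show ?case
        using elim by (simp add: scaleR_diff_right[symmetric] divide_inverse mult.commute)
    qed
    from tendsto_le[OF _ r l this] show "norm (F b - F a) \<le> B * (b - a)"
      by simp
  qed (fact N(1))
qed

section \<open>The essential image\<close>

text \<open>The complement of the essential image is a union of open sets with null preimage. By
  Lindelof countably many of them suffice, so its whole preimage is null.\<close>

lemma AE_in_ess_im:
  assumes v: "v \<in> borel_measurable lebesgue"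
  shows "AE x in lebesgue. v x \<in> ess_im v"
proof -
  define \<F> where "\<F> = {W. open W \<and> emeasure lebesgue (v -` W) = 0}"
  obtain \<F>' where \<F>': "\<F>' \<subseteq> \<F>" "countable \<F>'" "\<Union>\<F>' = \<Union>\<F>"
    using Lindelof[of \<F>] by (auto simp: \<F>_def)
  have "v -` W \<in> null_sets lebesgue" if "W \<in> \<F>'" for W
    using that \<F>' measurable_sets[OF v, of W] by (auto simp: \<F>_def null_sets_def)
  then have "(\<Union>W\<in>\<F>'. v -` W) \<in> null_sets lebesgue"
    using \<F>'(2) by (intro null_sets_UN') auto
  then have "AE x in lebesgue. x \<notin> (\<Union>W\<in>\<F>'. v -` W)"
    by (rule AE_not_in)
  then show ?thesis
  proof eventually_elim
    case (elim x)
    then have "v x \<notin> \<Union>\<F>"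
      using \<F>'(3) by auto
    then show ?case
      by (auto simp: ess_im_on_def \<F>_def zero_less_iff_neq_zero)
  qed
qed

lemma closed_ess_im_on: "closed (ess_im_on v J)"
proof -
  have "- ess_im_on v J = \<Union>{W. open W \<and> emeasure lebesgue (v -` W \<inter> J) = 0}"
    by (auto simp: ess_im_on_def zero_less_iff_neq_zero)
  then show ?thesis
    unfolding closed_def by auto
qed

lemma ess_im_subset_cball:
  fixes v :: "real \<Rightarrow> real^'n"
  assumes "AE x in lebesgue. norm (v x) \<le> B"
  shows "ess_im v \<subseteq> cball 0 B"
proof
  fix u assume u: "u \<in> ess_im v"
  show "u \<in> cball 0 B"
  proof (rule ccontr)
    assume "u \<notin> cball 0 B"
    moreover have "open (- cball 0 B :: (real^'n) set)"
      by (intro open_Compl closed_cball)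
    ultimately have "emeasure lebesgue (v -` (- cball 0 B) \<inter> UNIV) > 0"
      using u unfolding ess_im_on_def by blast
    moreover have "emeasure lebesgue (v -` (- cball 0 B)) = 0"
      using AE_E2[OF assms] by (simp add: vimage_def)
    ultimately show False
      by simp
  qed
qed

text \<open>Compactness makes a flux that is continuous on the essential image bounded
  there.\<close>

lemma compact_ess_im:
  assumes "L_infinity v"
  shows "compact (ess_im v)"
proof -
  obtain B where "AE x in lebesgue. norm (v x) \<le> B"
    using assms by (auto simp: L_infinity_def)
  from ess_im_subset_cball[OF this] have "bounded (ess_im v)"
    by (rule bounded_subset[OF bounded_cball])
  then show ?thesis
    by (simp add: compact_eq_bounded_closed closed_ess_im_on)
qed

text \<open>A set of positive measure is not contained in a null set. This selects points of
  \<open>J\<close> outside the exceptional set with values near \<open>u\<close>.\<close>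

lemma ess_im_on_meets:
  assumes "u \<in> ess_im_on v J" "open W" "u \<in> W" "negligible N"
  obtains x where "x \<in> J" "v x \<in> W" "x \<notin> N"
proof -
  have "v -` W \<inter> J \<notin> null_sets lebesgue"
    using assms by (auto simp: ess_im_on_def null_sets_def)
  then have "\<not> v -` W \<inter> J \<subseteq> N"
    using assms(4) negligible_subset negligible_iff_null_sets by blast
  then show thesis
    using that by auto
qed

lemma ess_im_on_subset_ess_im:
  assumes v: "v \<in> borel_measurable lebesgue"
  shows "ess_im_on v J \<subseteq> ess_im v"
proof
  fix u assume u: "u \<in> ess_im_on v J"
  show "u \<in> ess_im v"
    unfolding ess_im_on_def
  proof (clarify)
    fix W assume W: "open W" "u \<in> W"
    then have "0 < emeasure lebesgue (v -` W \<inter> J)"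
      using u by (auto simp: ess_im_on_def)
    \<comment> \<open>Monotonicity requires the larger set to be measurable, since
      \<open>emeasure\<close> is 0 on nonmeasurable sets.\<close>
    also have "\<dots> \<le> emeasure lebesgue (v -` W \<inter> UNIV)"
      using measurable_sets[OF v, of W] W by (intro emeasure_mono) auto
    finally show "0 < emeasure lebesgue (v -` W \<inter> UNIV)" .
  qed
qed

lemma tendsto_if_dist_le_inverse_Suc:
  assumes "\<And>n. dist (x n) l \<le> inverse (real (Suc n))"
  shows "x \<longlonglongrightarrow> l"
  unfolding tendsto_dist_iff[of x l]
  by (rule Lim_null_comparison[OF _ LIMSEQ_inverse_real_of_nat]) (use assms in simp)

lemma C2_on_imp_continuous_on: "C2_on f U \<Longrightarrow> continuous_on U f"
proof (intro continuous_at_imp_continuous_on ballI)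
  fix x assume "C2_on f U" "x \<in> U"
  then obtain f' where "(f has_derivative f') (at x)"
    unfolding C2_on_def by blast
  then show "isCont f x"
    by (rule has_derivative_continuous)
qed

section \<open>The flux of a self-similar weak solution\<close>

text \<open>The flux has weak derivative \<open>- v\<close>, so an essential bound of
  \<open>v\<close> serves as the Lipschitz constant \<open>B\<close>.\<close>

lemma flux_lipschitz_off_negligible:
  fixes v :: "real \<Rightarrow> real^'n"
  assumes cont: "continuous_on U f" and sol: "self_similar_weak_solution U f v"
  obtains B N where "negligible N"
    "\<And>a b. a \<notin> N \<Longrightarrow> b \<notin> N \<Longrightarrow> a \<le> b \<Longrightarrow>
      norm ((- b *\<^sub>R v b + f (v b)) - (- a *\<^sub>R v a + f (v a))) \<le> B * (b - a)"
proof -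
  define F where "F x = - x *\<^sub>R v x + f (v x)" for x
  from sol have Linf: "L_infinity v" and KU: "ess_im v \<subseteq> U"
    and weak: "\<And>\<psi>. C1_compact_support \<psi> \<Longrightarrow>
      (LINT x|lebesgue. vector_derivative \<psi> (at x) \<bullet> F x - \<psi> x \<bullet> v x) = 0"
    by (auto simp: self_similar_weak_solution_def strictly_hyperbolic_def F_def)
  from Linf obtain B where v[measurable]: "v \<in> borel_measurable lebesgue"
    and B: "AE x in lebesgue. norm (v x) \<le> B"
    by (auto simp: L_infinity_def)
  define K where "K = ess_im v"
  have K: "compact K" "K \<subseteq> U" and AEK: "AE x in lebesgue. v x \<in> K"
    using compact_ess_im[OF Linf] KU AE_in_ess_im[OF v] by (auto simp: K_def)
  have contK: "continuous_on K f"
    using cont K continuous_on_subset by blast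
  then obtain C where C: "\<And>u. u \<in> K \<Longrightarrow> norm (f u) \<le> C"
    using compact_continuous_image[OF _ K(1)] compact_imp_bounded bounded_iff
    by (metis imageI)
  \<comment> \<open>Outside \<open>U\<close> nothing is known about \<open>f\<close>. Its cutoff to
    \<open>K\<close> is Borel, and composed with \<open>v\<close> it agrees almost everywhere with
    \<open>f (v x)\<close>; completeness of Lebesgue measure transfers measurability.\<close>
  have [measurable]: "(\<lambda>u. indicat_real K u *\<^sub>R f u) \<in> borel_measurable borel"
    using K contK by (intro borel_measurable_continuous_on_indicator) (auto intro: borel_compact)
  have "(\<lambda>x. indicat_real K (v x) *\<^sub>R f (v x)) \<in> borel_measurable lebesgue"
    by measurable
  then have [measurable]: "(\<lambda>x. f (v x)) \<in> borel_measurable lebesgue"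
    by (rule borel_measurable_AE) (use AEK in eventually_elim, simp)
  have [measurable]: "(\<lambda>x::real. x) \<in> borel_measurable lebesgue"
    by (intro measurable_completion) simp
  have measF[measurable]: "F \<in> borel_measurable lebesgue"
    unfolding F_def by measurable
  have intF: "set_integrable lebesgue {a..b} F" for a b
    unfolding set_integrable_def
  proof (rule integrableI_bounded_set_indicator[where B = "(\<bar>a\<bar> + \<bar>b\<bar>) * B + C"])
    show "AE x in lebesgue. x \<in> {a..b} \<longrightarrow> norm (F x) \<le> (\<bar>a\<bar> + \<bar>b\<bar>) * B + C"
      using AEK B
    proof eventually_elim
      case (elim x)
      show ?case
      proof
        assume x: "x \<in> {a..b}"
        have "norm (F x) \<le> \<bar>x\<bar> * norm (v x) + norm (f (v x))"
          unfolding F_def by (rule order_trans[OF norm_triangle_ineq]) simp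
        also have "\<dots> \<le> (\<bar>a\<bar> + \<bar>b\<bar>) * B + C"
          using elim x by (intro add_mono mult_mono C) auto
        finally show "norm (F x) \<le> (\<bar>a\<bar> + \<bar>b\<bar>) * B + C" .
      qed
    qed
  qed (auto simp: emeasure_lborel_Icc_eq)
  \<comment> \<open>The bound \<open>R\<close> yields compact support, and
    \<open>vector_derivative\<close> recovers \<open>\<psi>'\<close>.\<close>
  have weak': "has_weak_derivative F (\<lambda>x. - v x)"
    unfolding has_weak_derivative_def
  proof (intro allI impI, elim conjE)
    fix \<psi> \<psi>' :: "real \<Rightarrow> real^'n" and R
    assume d: "\<forall>x. (\<psi> has_vector_derivative \<psi>' x) (at x)" and c: "continuous_on UNIV \<psi>'"
      and s: "\<forall>x. R < \<bar>x\<bar> \<longrightarrow> \<psi> x = 0"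
    have "{x. \<psi> x \<noteq> 0} \<subseteq> {-R..R}"
      using s by (force simp: not_less[symmetric])
    then have "bounded {x. \<psi> x \<noteq> 0}"
      using bounded_subset bounded_closed_interval by blast
    then have "C1_compact_support \<psi>"
      unfolding C1_compact_support_def C1_differentiable_on_def using c d by auto
    from weak[OF this] show "(LINT x|lebesgue. \<psi>' x \<bullet> F x + \<psi> x \<bullet> - v x) = 0"
      by (simp add: vector_derivative_at[OF d[rule_format]])
  qed
  obtain N where N: "negligible N"
    "\<And>a b. a \<notin> N \<Longrightarrow> b \<notin> N \<Longrightarrow> a \<le> b \<Longrightarrow> norm (F b - F a) \<le> B * (b - a)"
    using weak_derivative_lipschitz_off_negligible[OF intF _ _ weak', of B] B by auto
  show thesis
    by (rule that[OF N(1)]) (rule N(2)[unfolded F_def])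
qed

section \<open>The Rankine--Hugoniot condition\<close>

theorem proposition7p1:
  fixes U :: "(real^'n) set"
    and f :: "real^'n \<Rightarrow> real^'n"
    and v :: "real \<Rightarrow> real^'n"
    and \<xi>s :: real
    and um up :: "real^'n"
  assumes "open U"
    and "C2_on f U"
    and "convex hull (strictly_hyperbolic U f) \<subseteq> U"
    and "self_similar_weak_solution U f v"
    and "ess_discontinuity_point v \<xi>s"
    and "um \<in> ess_acc_left v \<xi>s"
    and "up \<in> ess_acc_right v \<xi>s"
  shows "- \<xi>s *\<^sub>R (up - um) + f up - f um = 0"
proof -
  define F where "F x = - x *\<^sub>R v x + f (v x)" for x
  have cont: "continuous_on U f"
    using C2_on_imp_continuous_on assms(2) .
  obtain B N where N: "negligible N"
    "\<And>a b. a \<notin> N \<Longrightarrow> b \<notin> N \<Longrightarrow> a \<le> b \<Longrightarrow> norm (F b - F a) \<le> B * (b - a)"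
    by (rule flux_lipschitz_off_negligible[OF cont assms(4), folded F_def]) (rule that, assumption, blast)
  have v: "v \<in> borel_measurable lebesgue" and KU: "ess_im v \<subseteq> U"
    using assms(4)
    by (auto simp: self_similar_weak_solution_def L_infinity_def strictly_hyperbolic_def)
  have um: "um \<in> ess_im_on v {\<xi>s - r<..<\<xi>s}" and up: "up \<in> ess_im_on v {\<xi>s<..<\<xi>s + r}"
    if "0 < r" for r
    using that assms(6,7) by (auto simp: ess_acc_left_def ess_acc_right_def)
  \<comment> \<open>Both states must lie in \<open>U\<close> for \<open>f\<close> to be continuous
    at them; one window, \<open>r = 1\<close>, suffices.\<close>
  have inU: "um \<in> U" "up \<in> U"
    using um[of 1] up[of 1] ess_im_on_subset_ess_im[OF v] KU by auto
  \<comment> \<open>The windows \<open>J n\<close> vary with \<open>n\<close> while the balls around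
    \<open>u\<close> shrink like 1/(n+1), so position and value are controlled together.\<close>
  have approx: "\<exists>x. (\<forall>n::nat. x n \<in> J n \<and> x n \<notin> N) \<and> (\<lambda>n. v (x n)) \<longlonglongrightarrow> u"
    if "\<And>n. u \<in> ess_im_on v (J n)" for J u
  proof -
    have "\<exists>x. x \<in> J n \<and> v x \<in> ball u (inverse (Suc n)) \<and> x \<notin> N" for n
      using ess_im_on_meets[OF that open_ball _ N(1), of u "inverse (Suc n)" n] by auto
    then obtain x where x: "\<And>n. x n \<in> J n \<and> v (x n) \<in> ball u (inverse (Suc n)) \<and> x n \<notin> N"
      by metis
    have "dist (v (x n)) u \<le> inverse (real (Suc n))" for n
      using x[of n] by (simp add: dist_commute)
    then have "(\<lambda>n. v (x n)) \<longlonglongrightarrow> u"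
      by (rule tendsto_if_dist_le_inverse_Suc)
    with x show ?thesis
      by blast
  qed
  obtain a where a: "\<And>n. a n \<in> {\<xi>s - inverse (Suc n)<..<\<xi>s}" "\<And>n. a n \<notin> N"
      "(\<lambda>n. v (a n)) \<longlonglongrightarrow> um"
    using approx[OF um, of "\<lambda>n. inverse (Suc n)"] by auto
  obtain b where b: "\<And>n. b n \<in> {\<xi>s<..<\<xi>s + inverse (Suc n)}" "\<And>n. b n \<notin> N"
      "(\<lambda>n. v (b n)) \<longlonglongrightarrow> up"
    using approx[OF up, of "\<lambda>n. inverse (Suc n)"] by auto
  have alim: "a \<longlonglongrightarrow> \<xi>s"
  proof (rule tendsto_if_dist_le_inverse_Suc)
    show "dist (a n) \<xi>s \<le> inverse (real (Suc n))" for n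
      using a(1)[of n] by (auto simp: dist_real_def simp del: of_nat_Suc)
  qed
  have blim: "b \<longlonglongrightarrow> \<xi>s"
  proof (rule tendsto_if_dist_le_inverse_Suc)
    show "dist (b n) \<xi>s \<le> inverse (real (Suc n))" for n
      using b(1)[of n] by (auto simp: dist_real_def simp del: of_nat_Suc)
  qed
  \<comment> \<open>\<open>v\<close> need not have a one-sided limit at \<open>\<xi>s\<close>; only
    its values along the chosen sequence converge. Openness of \<open>U\<close> gives continuity of
    \<open>f\<close> at \<open>u\<close>.\<close>
  have Flim: "(\<lambda>n. F (x n)) \<longlonglongrightarrow> - \<xi>s *\<^sub>R u + f u"
    if "x \<longlonglongrightarrow> \<xi>s" "(\<lambda>n. v (x n)) \<longlonglongrightarrow> u" "u \<in> U" for x u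
  proof -
    have "isCont f u"
      using cont assms(1) that(3) continuous_on_eq_continuous_at by blast
    then show ?thesis
      unfolding F_def by (intro tendsto_intros that isCont_tendsto_compose[of u f])
  qed
  have "(\<lambda>n. norm (F (b n) - F (a n))) \<longlonglongrightarrow> norm ((- \<xi>s *\<^sub>R up + f up) - (- \<xi>s *\<^sub>R um + f um))"
    by (intro tendsto_intros Flim alim blim a(3) b(3) inU)
  moreover have "(\<lambda>n. B * (b n - a n)) \<longlonglongrightarrow> B * (\<xi>s - \<xi>s)"
    by (intro tendsto_intros alim blim)
  \<comment> \<open>\<open>\<xi>s\<close> separates \<open>a n\<close> from \<open>b n\<close>,
    which gives the required order \<open>a n\<close> \<le> \<open>b n\<close>.\<close>
  moreover have "norm (F (b n) - F (a n)) \<le> B * (b n - a n)" for n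
    using N(2)[OF a(2) b(2), of n n] a(1)[of n] b(1)[of n] by auto
  \<comment> \<open>The right-hand side is 0, so the two limits of the flux coincide.\<close>
  ultimately have "norm ((- \<xi>s *\<^sub>R up + f up) - (- \<xi>s *\<^sub>R um + f um)) \<le> B * (\<xi>s - \<xi>s)"
    by (intro LIMSEQ_le) auto
  then show ?thesis
    by (simp add: algebra_simps)
qed

end
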